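(* Let $(E,d_E)$ be a complete separable metric space with Borel $\sigma$-algebra $\mathcal E$, let $\mu$ be a probability measure on $(E,\mathcal E)$, and let $\Phi,\widetilde\Phi\colon E\to\mathbb R$ belong to $L^2_\mu(\mathbb R)$ with $\operatorname{ess\,inf}_\mu\Phi=0$. Put $Z:=\int_E e^{-\Phi}\,d\mu$ and $\widetilde Z:=\int_E e^{-\widetilde\Phi}\,d\mu$ (both in $(0,\infty)$), and define the probability measures $$\mu_\Phi(dx):=\frac1Z e^{-\Phi(x)}\,\mu(dx),\qquad \mu_{\widetilde\Phi}(dx):=\frac1{\widetilde Z}e^{-\widetilde\Phi(x)}\,\mu(dx).$$ Then $$d_{\mathrm H}(\mu_\Phi,\mu_{\widetilde\Phi})\le \frac{\exp\left(-[\operatorname{ess\,inf}_\mu\widetilde\Phi]_-\right)}{\min(Z,\widetilde Z)}\,\|\Phi-\widetilde\Phi\|_{L^2_\mu}.$$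
   Context: $[t]_-:=\min(0,t)$. The Hellinger distance of probability measures $\mu,\widetilde\mu$ on $E$ is (without normalizing factor) given by $d_{\mathrm H}^2(\mu,\widetilde\mu):=\int_E\left(\sqrt{\frac{d\mu}{d\nu}}-\sqrt{\frac{d\widetilde\mu}{d\nu}}\right)^2 d\nu$, where $\nu$ is any measure dominating both (e.g. $\nu=\frac12\mu+\frac12\widetilde\mu$). $L^p_\mu(\mathbb R)$ is the space of measurable real functions that are $p$-integrable with respect to $\mu$, with norm $\|\cdot\|_{L^p_\mu}$. If $\operatorname{ess\,inf}_\mu\widetilde\Phi=-\infty$ the right-hand side is read as $+\infty$. *)

theory Defs
  imports "HOL-Probability.Probability" "HOL-Probability.Essential_Supremum"
begin

definition L_space :: "real \<Rightarrow> 'a measure \<Rightarrow> ('a \<Rightarrow> real) set" where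
  "L_space p M = {f. f \<in> borel_measurable M \<and> integrable M (\<lambda>x. \<bar>f x\<bar> powr p)}"

definition L_norm :: "real \<Rightarrow> 'a measure \<Rightarrow> ('a \<Rightarrow> real) \<Rightarrow> real" where
  "L_norm p M f = (\<integral>x. \<bar>f x\<bar> powr p \<partial>M) powr (1 / p)"

definition essinf :: "'a measure \<Rightarrow> ('a \<Rightarrow> real) \<Rightarrow> ereal" where
  "essinf M f = - esssup M (\<lambda>x. - ereal (f x))"

lemma essinf_eq_Sup:
  assumes [measurable]: "f \<in> borel_measurable M"
  shows "essinf M f = Sup {z. AE x in M. z \<le> ereal (f x)}"
proof -
  have "uminus ` {z. AE x in M. - ereal (f x) \<le> z} = {z. AE x in M. z \<le> ereal (f x)}"
  proof (intro set_eqI iffI)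
    fix z assume "z \<in> {z. AE x in M. z \<le> ereal (f x)}"
    then have "- z \<in> {z. AE x in M. - ereal (f x) \<le> z}"
      by (simp del: uminus_ereal.simps)
    then show "z \<in> uminus ` {z. AE x in M. - ereal (f x) \<le> z}"
      by (metis (no_types, lifting) ereal_uminus_uminus image_eqI)
  next
    fix z assume "z \<in> uminus ` {z. AE x in M. - ereal (f x) \<le> z}"
    then show "z \<in> {z. AE x in M. z \<le> ereal (f x)}"
      by (auto simp: ereal_uminus_le_reorder simp del: uminus_ereal.simps)
  qed
  moreover have "esssup M (\<lambda>x. - ereal (f x)) = Inf {z. AE x in M. - ereal (f x) \<le> z}"
    by (rule esssup_eq_AE) measurable
  ultimately show ?thesis
    unfolding essinf_def by (metis ereal_Sup_uminus_image_eq ereal_uminus_uminus)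
qed

definition partition_const :: "'a measure \<Rightarrow> ('a \<Rightarrow> real) \<Rightarrow> real" where
  "partition_const M \<Phi> = (\<integral>x. exp (- \<Phi> x) \<partial>M)"

definition gibbs_measure :: "'a measure \<Rightarrow> ('a \<Rightarrow> real) \<Rightarrow> 'a measure" where
  "gibbs_measure M \<Phi> = density M (\<lambda>x. ennreal (exp (- \<Phi> x) / partition_const M \<Phi>))"

lemma sets_gibbs_measure [simp]: "sets (gibbs_measure M \<Phi>) = sets M"
  by (simp add: gibbs_measure_def)

lemma partition_const_pos:
  assumes "prob_space M" "integrable M (\<lambda>x. exp (- \<Phi> x))"
  shows "0 < partition_const M \<Phi>"
proof -
  interpret prob_space M by fact
  show ?thesis
    unfolding partition_const_def by (rule expectation_greater) (use assms in auto)
qed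

lemma prob_space_gibbs_measure:
  assumes "prob_space M" and I: "integrable M (\<lambda>x. exp (- \<Phi> x))"
  shows "prob_space (gibbs_measure M \<Phi>)"
proof
  have Z: "0 < partition_const M \<Phi>"
    using assms by (rule partition_const_pos)
  have [measurable]: "(\<lambda>x. exp (- \<Phi> x)) \<in> borel_measurable M"
    using I by (rule borel_measurable_integrable)
  have "emeasure (gibbs_measure M \<Phi>) (space M)
      = (\<integral>\<^sup>+x. ennreal (exp (- \<Phi> x) / partition_const M \<Phi>) \<partial>M)"
    unfolding gibbs_measure_def by (subst emeasure_density) (auto intro!: nn_integral_cong)
  also have "\<dots> = ennreal (\<integral>x. exp (- \<Phi> x) / partition_const M \<Phi> \<partial>M)"
    using I Z by (intro nn_integral_eq_integral) auto
  also have "\<dots> = 1"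
    using Z by (simp add: partition_const_def)
  finally show "emeasure (gibbs_measure M \<Phi>) (space (gibbs_measure M \<Phi>)) = 1"
    by (simp add: gibbs_measure_def)
qed

text \<open>A finite essential infimum makes the partition constant finite.\<close>

lemma integrable_exp_neg:
  assumes "prob_space M" and [measurable]: "\<Phi> \<in> borel_measurable M"
    and "essinf M \<Phi> \<noteq> - \<infinity>"
  shows "integrable M (\<lambda>x. exp (- \<Phi> x))"
proof -
  interpret prob_space M by fact
  have "- \<infinity> < essinf M \<Phi>" using assms(3) by auto
  then obtain z where z: "AE x in M. z \<le> ereal (\<Phi> x)" "- \<infinity> < z"
    unfolding essinf_eq_Sup[OF assms(2)] less_Sup_iff by auto
  then obtain c where "AE x in M. c \<le> \<Phi> x"
  proof (cases z)
    case (real r) then show ?thesis using z that by auto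
  next
    case PInf then show ?thesis using z that[of 0] by auto
  qed auto
  then have "AE x in M. norm (exp (- \<Phi> x)) \<le> exp (- c)"
    by eventually_elim simp
  then show ?thesis
    by (rule integrable_const_bound) measurable
qed

definition midpoint_measure :: "'a measure \<Rightarrow> 'a measure \<Rightarrow> 'a measure" where
  "midpoint_measure M N = measure_of (space M) (sets M) (\<lambda>A. (emeasure M A + emeasure N A) / 2)"

definition hellinger_sq_wrt :: "'a measure \<Rightarrow> 'a measure \<Rightarrow> 'a measure \<Rightarrow> real" where
  "hellinger_sq_wrt V M N =
     (\<integral>x. (sqrt (enn2real (RN_deriv V M x)) - sqrt (enn2real (RN_deriv V N x)))\<^sup>2 \<partial>V)"

text \<open>The value does not depend on the dominating measure; see \<open>hellinger_dist_eq\<close> below.\<close>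

definition hellinger_dist :: "'a measure \<Rightarrow> 'a measure \<Rightarrow> real" where
  "hellinger_dist M N = sqrt (hellinger_sq_wrt (midpoint_measure M N) M N)"

lemma sets_midpoint_measure [simp]: "sets (midpoint_measure M N) = sets M"
  by (simp add: midpoint_measure_def)

lemma space_midpoint_measure [simp]: "space (midpoint_measure M N) = space M"
  by (simp add: midpoint_measure_def)

lemma emeasure_midpoint_measure:
  assumes "sets N = sets M" "A \<in> sets M"
  shows "emeasure (midpoint_measure M N) A = (emeasure M A + emeasure N A) / 2"
proof (rule emeasure_measure_of[OF midpoint_measure_def])
  show "countably_additive (sets (midpoint_measure M N)) (\<lambda>A. (emeasure M A + emeasure N A) / 2)"
  proof (rule countably_additiveI)
    fix F :: "nat \<Rightarrow> _"
    assume F: "range F \<subseteq> sets (midpoint_measure M N)" "disjoint_family F"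
    then have "(\<Sum>i. emeasure M (F i)) = emeasure M (\<Union>i. F i)"
      "(\<Sum>i. emeasure N (F i)) = emeasure N (\<Union>i. F i)"
      using assms by (auto intro!: suminf_emeasure)
    then show "(\<Sum>i. (emeasure M (F i) + emeasure N (F i)) / 2)
        = (emeasure M (\<Union>i. F i) + emeasure N (\<Union>i. F i)) / 2"
      by (simp add: divide_ennreal_def suminf_add[symmetric])
  qed
qed (use assms sets.space_closed in \<open>auto simp: positive_def\<close>)

lemma prob_space_midpoint_measure:
  assumes "prob_space M" "prob_space N" "sets N = sets M"
  shows "prob_space (midpoint_measure M N)"
proof
  have "space N = space M" using assms(3) by (rule sets_eq_imp_space_eq)
  then show "emeasure (midpoint_measure M N) (space (midpoint_measure M N)) = 1"
    using prob_space.emeasure_space_1[OF assms(1)] prob_space.emeasure_space_1[OF assms(2)]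
    by (simp add: emeasure_midpoint_measure[OF assms(3)])
qed

lemma absolutely_continuous_midpoint_measure:
  assumes "sets N = sets M"
  shows "absolutely_continuous (midpoint_measure M N) M"
    and "absolutely_continuous (midpoint_measure M N) N"
  using assms
  by (auto simp: absolutely_continuous_def null_sets_def emeasure_midpoint_measure)

text \<open>The Bochner integral in \<open>hellinger_sq_wrt\<close> is never a default value.\<close>

lemma integrable_hellinger:
  assumes "sigma_finite_measure V" "finite_measure M" "finite_measure N"
    and "sets M = sets V" "sets N = sets V"
    and "absolutely_continuous V M" "absolutely_continuous V N"
  shows "integrable V (\<lambda>x. (sqrt (enn2real (RN_deriv V M x)) - sqrt (enn2real (RN_deriv V N x)))\<^sup>2)"
proof -
  interpret V: sigma_finite_measure V by fact
  have I: "integrable V (\<lambda>x. enn2real (RN_deriv V P x))"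
    if "finite_measure P" "sets P = sets V" "absolutely_continuous V P" for P
  proof -
    interpret P: finite_measure P by fact
    have "(\<integral>\<^sup>+x. RN_deriv V P x \<partial>V) = emeasure P (space P)"
      using V.RN_deriv_nn_integral[OF that(3,2), of "\<lambda>_. 1"] by simp
    moreover have "(\<integral>\<^sup>+x. ennreal (enn2real (RN_deriv V P x)) \<partial>V) \<le> (\<integral>\<^sup>+x. RN_deriv V P x \<partial>V)"
      by (intro nn_integral_mono) (metis enn2real_top ennreal_0 ennreal_enn2real le_less less_top zero_le)
    ultimately show ?thesis
      by (intro integrableI_bounded) (auto simp: less_top[symmetric] top_unique)
  qed
  have "(sqrt a - sqrt b)\<^sup>2 \<le> a + b" if "0 \<le> a" "0 \<le> b" for a b :: real
    using that by (simp add: power2_diff)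
  then show ?thesis
    using assms
    by (intro Bochner_Integration.integrable_bound[OF Bochner_Integration.integrable_add[OF I[of M] I[of N]]])
      auto
qed

lemma hellinger_dist_eq:
  assumes M: "prob_space M" and N: "prob_space N" and V: "sigma_finite_measure V"
    and sets: "sets M = sets V" "sets N = sets V"
    and ac: "absolutely_continuous V M" "absolutely_continuous V N"
  shows "hellinger_dist M N = sqrt (hellinger_sq_wrt V M N)"
proof -
  define R where "R = midpoint_measure M N"
  interpret M: prob_space M by fact
  interpret N: prob_space N by fact
  interpret V: sigma_finite_measure V by fact
  have NM: "sets N = sets M" using sets by simp
  interpret R: prob_space R
    unfolding R_def using M N NM by (rule prob_space_midpoint_measure)
  have sR: "sets R = sets V" by (simp add: R_def sets)
  have acR: "absolutely_continuous V R"
    using ac sets by (auto simp: absolutely_continuous_def null_sets_def R_def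
        emeasure_midpoint_measure[OF NM] subset_eq)
  have dR: "density V (RN_deriv V R) = R"
    by (rule V.density_RN_deriv[OF acR sR])
  have fR: "AE x in V. RN_deriv V R x \<noteq> \<infinity>"
    by (rule V.RN_deriv_finite[OF _ acR sR]) unfold_locales
  have chain: "AE x in V. RN_deriv V R x * RN_deriv R P x = RN_deriv V P x"
    if "absolutely_continuous R P" "sets P = sets V" for P
  proof -
    have [measurable]: "RN_deriv R P \<in> borel_measurable V"
      using borel_measurable_RN_deriv[of R P] measurable_cong_sets[OF sR refl] by blast
    have "density V (\<lambda>x. RN_deriv V R x * RN_deriv R P x) = density (density V (RN_deriv V R)) (RN_deriv R P)"
      by (subst density_density_eq) auto
    also have "\<dots> = P"
      unfolding dR using that sR by (intro R.density_RN_deriv) auto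
    finally show ?thesis
      by (intro V.RN_deriv_unique) auto
  qed
  have [measurable]: "RN_deriv R M \<in> borel_measurable V" "RN_deriv R N \<in> borel_measurable V"
    using borel_measurable_RN_deriv[of R] measurable_cong_sets[OF sR refl] by blast+
  let ?g = "\<lambda>x. (sqrt (enn2real (RN_deriv R M x)) - sqrt (enn2real (RN_deriv R N x)))\<^sup>2"
  have "AE x in V. ennreal (enn2real (RN_deriv V R x)) = RN_deriv V R x"
    using fR by eventually_elim (simp add: less_top)
  then have "R = density V (\<lambda>x. ennreal (enn2real (RN_deriv V R x)))"
    by (subst dR[symmetric], intro density_cong) auto
  then have "hellinger_sq_wrt R M N
      = (\<integral>x. ?g x \<partial>density V (\<lambda>x. ennreal (enn2real (RN_deriv V R x))))"
    unfolding hellinger_sq_wrt_def by (rule arg_cong)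
  also have "\<dots> = (\<integral>x. enn2real (RN_deriv V R x) * ?g x \<partial>V)"
    by (rule integral_real_density) auto
  also have "\<dots> = hellinger_sq_wrt V M N"
    unfolding hellinger_sq_wrt_def
  proof (rule integral_cong_AE)
    show "AE x in V. enn2real (RN_deriv V R x) * ?g x
        = (sqrt (enn2real (RN_deriv V M x)) - sqrt (enn2real (RN_deriv V N x)))\<^sup>2"
      using chain[OF absolutely_continuous_midpoint_measure(1)[OF NM, folded R_def] sets(1)]
        chain[OF absolutely_continuous_midpoint_measure(2)[OF NM, folded R_def] sets(2)]
    proof eventually_elim
      case a: (elim x)
      let ?r = "enn2real (RN_deriv V R x)"
      have "?r * ?g x = (sqrt ?r * (sqrt (enn2real (RN_deriv R M x)) - sqrt (enn2real (RN_deriv R N x))))\<^sup>2"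
        by (simp add: power_mult_distrib)
      then show "?r * ?g x = (sqrt (enn2real (RN_deriv V M x)) - sqrt (enn2real (RN_deriv V N x)))\<^sup>2"
        by (simp add: a[symmetric] enn2real_mult real_sqrt_mult right_diff_distrib)
    qed
  qed auto
  finally show ?thesis
    by (simp add: hellinger_dist_def R_def)
qed

end

theory Submission
  imports Defs
begin

text \<open>
  Write \<open>u = exp (- \<Phi> / 2)\<close> and \<open>v = exp (- \<Phi>' / 2)\<close>, vectors of \<open>L\<^sup>2(\<mu>)\<close> with norms
  \<open>\<surd>Z\<close> and \<open>\<surd>Z'\<close>. The Hellinger distance is the distance of the normalised vectors, and in
  any Hilbert space the distance of \<open>u / \<parallel>u\<parallel>\<close> and \<open>v / \<parallel>v\<parallel>\<close> is at most
  \<open>\<parallel>u - v\<parallel> / \<surd>(\<parallel>u\<parallel> \<parallel>v\<parallel>)\<close>. Since \<open>exp\<close> is Lipschitz on half-lines, \<open>\<parallel>u - v\<parallel>\<close> is at most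
  \<open>exp (- m / 2) / 2\<close> times \<open>\<parallel>\<Phi> - \<Phi>'\<parallel>\<close>, where \<open>m\<close> is the minimum of \<open>0\<close> and the
  essential infimum of \<open>\<Phi>'\<close>. As \<open>Z \<le> 1\<close> and \<open>m \<le> 0\<close>, this is stronger than the claim.
\<close>

lemma AE_essinf_le:
  assumes [measurable]: "f \<in> borel_measurable M"
  shows "AE x in M. essinf M f \<le> ereal (f x)"
proof -
  have "AE x in M. - ereal (f x) \<le> esssup M (\<lambda>x. - ereal (f x))"
    by (rule esssup_AE)
  then show ?thesis
    unfolding essinf_def by eventually_elim (metis ereal_uminus_le_reorder)
qed

lemma L_norm_2: "L_norm 2 M f = sqrt (\<integral>x. (f x)\<^sup>2 \<partial>M)"
  by (simp add: L_norm_def powr_half_sqrt)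

lemma L_space_2: "L_space 2 M = {f. f \<in> borel_measurable M \<and> integrable M (\<lambda>x. (f x)\<^sup>2)}"
  by (simp add: L_space_def)

lemma L_space_2_diff:
  assumes "f \<in> L_space 2 M" "g \<in> L_space 2 M"
  shows "(\<lambda>x. f x - g x) \<in> L_space 2 M"
proof -
  have [measurable]: "f \<in> borel_measurable M" "g \<in> borel_measurable M"
    and I: "integrable M (\<lambda>x. 2 * (f x)\<^sup>2 + 2 * (g x)\<^sup>2)"
    using assms by (auto simp: L_space_2)
  have "(a - b)\<^sup>2 \<le> 2 * a\<^sup>2 + 2 * b\<^sup>2" for a b :: real
    using zero_le_power2[of "a + b"] by (simp add: power2_sum power2_diff)
  then have "integrable M (\<lambda>x. (f x - g x)\<^sup>2)"
    by (intro Bochner_Integration.integrable_bound[OF I]) auto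
  then show ?thesis
    by (simp add: L_space_2)
qed

text \<open>As the distance is the same for every dominating measure, \<open>V\<close> can replace
  the midpoint measure; uniqueness of Radon-Nikodym derivatives then identifies them with
  \<open>f\<close> and \<open>g\<close> almost everywhere.\<close>

lemma hellinger_dist_density:
  assumes "sigma_finite_measure V"
    and [measurable]: "f \<in> borel_measurable V" "g \<in> borel_measurable V"
    and nonneg: "\<And>x. 0 \<le> f x" "\<And>x. 0 \<le> g x"
    and prob: "prob_space (density V (\<lambda>x. ennreal (f x)))"
      "prob_space (density V (\<lambda>x. ennreal (g x)))"
  shows "hellinger_dist (density V (\<lambda>x. ennreal (f x))) (density V (\<lambda>x. ennreal (g x)))
    = sqrt (\<integral>x. (sqrt (f x) - sqrt (g x))\<^sup>2 \<partial>V)"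
proof -
  interpret V: sigma_finite_measure V by fact
  let ?M = "density V (\<lambda>x. ennreal (f x))" and ?N = "density V (\<lambda>x. ennreal (g x))"
  have "AE x in V. ennreal (f x) = RN_deriv V ?M x" "AE x in V. ennreal (g x) = RN_deriv V ?N x"
    by (intro V.RN_deriv_unique; simp)+
  then have "AE x in V. (sqrt (enn2real (RN_deriv V ?M x)) - sqrt (enn2real (RN_deriv V ?N x)))\<^sup>2
      = (sqrt (f x) - sqrt (g x))\<^sup>2"
    by eventually_elim (metis enn2real_ennreal nonneg)
  then have "hellinger_sq_wrt V ?M ?N = (\<integral>x. (sqrt (f x) - sqrt (g x))\<^sup>2 \<partial>V)"
    unfolding hellinger_sq_wrt_def by (intro integral_cong_AE) auto
  moreover have "hellinger_dist ?M ?N = sqrt (hellinger_sq_wrt V ?M ?N)"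
    using prob by (intro hellinger_dist_eq)
      (auto intro!: absolutely_continuousI_density V.sigma_finite_measure_axioms)
  ultimately show ?thesis
    by simp
qed

text \<open>With \<open>c\<close> the inner product of \<open>u\<close> and \<open>v\<close>,
  expanding turns the two sides into \<open>2 - 2 * c / (a * b)\<close> and
  \<open>(a^2 + b^2 - 2 * c) / (a * b)\<close>. They differ by \<open>(a - b)^2 / (a * b)\<close>,
  which is nonnegative.\<close>

lemma integral_normalized_diff_le:
  fixes u v :: "'a \<Rightarrow> real"
  assumes [measurable]: "u \<in> borel_measurable M" "v \<in> borel_measurable M"
    and I: "integrable M (\<lambda>x. (u x)\<^sup>2)" "integrable M (\<lambda>x. (v x)\<^sup>2)"
  defines "a \<equiv> sqrt (\<integral>x. (u x)\<^sup>2 \<partial>M)" and "b \<equiv> sqrt (\<integral>x. (v x)\<^sup>2 \<partial>M)"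
  assumes pos: "0 < a" "0 < b"
  shows "(\<integral>x. (u x / a - v x / b)\<^sup>2 \<partial>M) \<le> (\<integral>x. (u x - v x)\<^sup>2 \<partial>M) / (a * b)"
proof -
  have "\<bar>s * t\<bar> \<le> s\<^sup>2 + t\<^sup>2" for s t :: real
    using sum_squares_bound[of "\<bar>s\<bar>" "\<bar>t\<bar>"] mult_nonneg_nonneg[of "\<bar>s\<bar>" "\<bar>t\<bar>"]
    unfolding abs_mult power2_abs mult.assoc by linarith
  then have J: "integrable M (\<lambda>x. u x * v x)"
    by (intro Bochner_Integration.integrable_bound[OF Bochner_Integration.integrable_add[OF I]]) auto
  have a2: "(\<integral>x. (u x)\<^sup>2 \<partial>M) = a\<^sup>2" and b2: "(\<integral>x. (v x)\<^sup>2 \<partial>M) = b\<^sup>2"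
    by (simp_all add: a_def b_def)
  define c where "c = (\<integral>x. u x * v x \<partial>M)"
  \<comment> \<open>Used twice: \<open>s = 1 / a\<close>, \<open>t = 1 / b\<close> gives the
    left-hand side, and \<open>s = t = 1\<close> the integral on the right.\<close>
  have expand: "(\<integral>x. (s * u x - t * v x)\<^sup>2 \<partial>M) = s\<^sup>2 * a\<^sup>2 + t\<^sup>2 * b\<^sup>2 - 2 * s * t * c" for s t
  proof -
    have "(\<integral>x. (s * u x - t * v x)\<^sup>2 \<partial>M)
        = (\<integral>x. s\<^sup>2 * (u x)\<^sup>2 + t\<^sup>2 * (v x)\<^sup>2 - 2 * s * t * (u x * v x) \<partial>M)"
      by (intro Bochner_Integration.integral_cong) (auto simp: power2_diff power_mult_distrib)
    also have "\<dots> = s\<^sup>2 * a\<^sup>2 + t\<^sup>2 * b\<^sup>2 - 2 * s * t * c"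
      using I J by (simp add: a2 b2 c_def)
    finally show ?thesis .
  qed
  have "(\<integral>x. (u x / a - v x / b)\<^sup>2 \<partial>M) = 2 - 2 * c / (a * b)"
    using expand[of "1 / a" "1 / b"] pos by (simp add: power_divide)
  also have "\<dots> \<le> (a\<^sup>2 + b\<^sup>2 - 2 * c) / (a * b)"
    using pos zero_le_power2[of "a - b"]
    by (simp add: field_simps power2_diff)
  also have "a\<^sup>2 + b\<^sup>2 - 2 * c = (\<integral>x. (u x - v x)\<^sup>2 \<partial>M)"
    using expand[of 1 1] by simp
  finally show ?thesis .
qed

text \<open>By convexity, the graph of \<open>exp\<close> lies above its tangent at the larger of
  the two points, whose slope is at most \<open>exp m\<close>.\<close>

lemma abs_exp_diff_le:
  fixes s t m :: real
  assumes "s \<le> m" "t \<le> m"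
  shows "\<bar>exp s - exp t\<bar> \<le> exp m * \<bar>s - t\<bar>"
proof -
  have *: "exp y - exp x \<le> exp m * (y - x)" if "x \<le> y" "y \<le> m" for x y :: real
  proof -
    have "exp y - exp x = exp y * (1 - exp (x - y))"
      by (simp add: exp_diff right_diff_distrib)
    also have "\<dots> \<le> exp y * (y - x)"
    proof (rule mult_left_mono)
      show "1 - exp (x - y) \<le> y - x"
        using exp_ge_add_one_self[of "x - y"] by linarith
    qed simp
    also have "\<dots> \<le> exp m * (y - x)"
      using that by (intro mult_right_mono) auto
    finally show ?thesis .
  qed
  show ?thesis
  proof (cases "s \<le> t")
    case True
    then show ?thesis using *[of s t] assms by (simp add: abs_if)
  next
    case False
    then show ?thesis using *[of t s] assms by (simp add: abs_if)
  qed
qed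

text \<open>The roots of the densities have exponents \<open>- f x / 2\<close> and
  \<open>- g x / 2\<close>. The halving yields both the factor 1/2 and the exponent
  \<open>- m / 2\<close> of the Lipschitz constant.\<close>

lemma hellinger_dist_gibbs_measure_le:
  fixes m :: real
  assumes "prob_space M" and L: "f \<in> L_space 2 M" "g \<in> L_space 2 M"
    and AE: "AE x in M. m \<le> f x" "AE x in M. m \<le> g x"
    and I: "integrable M (\<lambda>x. exp (- f x))" "integrable M (\<lambda>x. exp (- g x))"
  shows "hellinger_dist (gibbs_measure M f) (gibbs_measure M g)
    \<le> exp (- m / 2) / (2 * sqrt (min (partition_const M f) (partition_const M g)))
      * L_norm 2 M (\<lambda>x. f x - g x)"
proof -
  interpret prob_space M by fact
  let ?Z = "partition_const M f" and ?Z' = "partition_const M g"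
  let ?D = "\<integral>x. (f x - g x)\<^sup>2 \<partial>M"
  define u v where "u x = exp (- f x / 2)" and "v x = exp (- g x / 2)" for x
  have [measurable]: "f \<in> borel_measurable M" "g \<in> borel_measurable M"
    using L by (auto simp: L_space_2)
  have [measurable]: "u \<in> borel_measurable M" "v \<in> borel_measurable M"
    unfolding u_def v_def by measurable
  have u2: "(u x)\<^sup>2 = exp (- f x)" and v2: "(v x)\<^sup>2 = exp (- g x)" for x
    by (simp_all add: u_def v_def flip: exp_double)
  have Z: "0 < ?Z" "0 < ?Z'"
    using partition_const_pos[OF \<open>prob_space M\<close>] I by auto
  have ID: "integrable M (\<lambda>x. (f x - g x)\<^sup>2)"
    using L_space_2_diff[OF L] by (simp add: L_space_2)
  have sq: "sqrt (exp (- f x) / ?Z) = u x / sqrt ?Z" "sqrt (exp (- g x) / ?Z') = v x / sqrt ?Z'" for x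
    by (simp_all add: real_sqrt_divide u_def v_def flip: u2 v2)
  have "hellinger_dist (gibbs_measure M f) (gibbs_measure M g)
      = sqrt (\<integral>x. (sqrt (exp (- f x) / ?Z) - sqrt (exp (- g x) / ?Z'))\<^sup>2 \<partial>M)"
    using Z prob_space_gibbs_measure[OF \<open>prob_space M\<close>] I unfolding gibbs_measure_def
    by (intro hellinger_dist_density) (auto intro: sigma_finite_measure_axioms)
  also have "\<dots> = sqrt (\<integral>x. (u x / sqrt ?Z - v x / sqrt ?Z')\<^sup>2 \<partial>M)"
    by (simp only: sq)
  also have "(\<integral>x. (u x / sqrt ?Z - v x / sqrt ?Z')\<^sup>2 \<partial>M)
      \<le> (\<integral>x. (u x - v x)\<^sup>2 \<partial>M) / (sqrt ?Z * sqrt ?Z')"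
    using integral_normalized_diff_le[of u M v] I Z by (simp add: u2 v2 partition_const_def)
  \<comment> \<open>The geometric mean of two positive numbers is at least their minimum.\<close>
  also have "\<dots> \<le> (\<integral>x. (u x - v x)\<^sup>2 \<partial>M) / min ?Z ?Z'"
  proof (rule divide_left_mono)
    have "sqrt (min ?Z ?Z') * sqrt (min ?Z ?Z') \<le> sqrt ?Z * sqrt ?Z'"
      using Z by (intro mult_mono) auto
    then show "min ?Z ?Z' \<le> sqrt ?Z * sqrt ?Z'"
      using Z by simp
  qed (use Z in auto)
  also have "(\<integral>x. (u x - v x)\<^sup>2 \<partial>M) \<le> (\<integral>x. (exp (- m / 2) / 2)\<^sup>2 * (f x - g x)\<^sup>2 \<partial>M)"
  proof (rule integral_mono_AE')
    show "AE x in M. (u x - v x)\<^sup>2 \<le> (exp (- m / 2) / 2)\<^sup>2 * (f x - g x)\<^sup>2"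
      using AE
    proof eventually_elim
      case (elim x)
      then have "\<bar>u x - v x\<bar> \<le> exp (- m / 2) * \<bar>- f x / 2 - (- g x / 2)\<bar>"
        unfolding u_def v_def by (intro abs_exp_diff_le) auto
      also have "\<dots> = \<bar>exp (- m / 2) / 2 * (f x - g x)\<bar>"
        by (simp add: abs_mult abs_minus_commute flip: diff_divide_distrib)
      finally show ?case
        unfolding abs_le_square_iff power_mult_distrib .
    qed
  qed (use ID in auto)
  also have "\<dots> / min ?Z ?Z' = (exp (- m / 2) / 2)\<^sup>2 * ?D / min ?Z ?Z'"
    by simp
  also have "sqrt \<dots> = exp (- m / 2) / 2 * sqrt ?D / sqrt (min ?Z ?Z')"
    by (simp add: real_sqrt_divide real_sqrt_mult)
  \<comment> \<open>The estimates concern the radicand and its numerator; monotonicity of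
    \<open>sqrt\<close> and of division by \<open>min ?Z ?Z'\<close> carries them to the whole
    expression.\<close>
  finally show ?thesis
    using Z by (simp add: L_norm_2 divide_right_mono)
qed

theorem theorem5:
  fixes \<mu> :: "'a :: polish_space measure"
    and \<Phi> \<Phi>' :: "'a \<Rightarrow> real"
  assumes "prob_space \<mu>" and "sets \<mu> = sets borel"
    and "\<Phi> \<in> L_space 2 \<mu>" and "\<Phi>' \<in> L_space 2 \<mu>"
    and "essinf \<mu> \<Phi> = 0"
    and "integrable \<mu> (\<lambda>x. exp (- \<Phi>' x))"
  shows "ereal (hellinger_dist (gibbs_measure \<mu> \<Phi>) (gibbs_measure \<mu> \<Phi>'))
    \<le> (if essinf \<mu> \<Phi>' = - \<infinity> then \<infinity>
        else ereal (exp (- real_of_ereal (min 0 (essinf \<mu> \<Phi>')))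
               / min (partition_const \<mu> \<Phi>) (partition_const \<mu> \<Phi>')
               * L_norm 2 \<mu> (\<lambda>x. \<Phi> x - \<Phi>' x)))"
proof (cases "essinf \<mu> \<Phi>' = - \<infinity>")
  case False
  interpret prob_space \<mu> by fact
  let ?Z = "partition_const \<mu> \<Phi>" and ?Z' = "partition_const \<mu> \<Phi>'"
  have [measurable]: "\<Phi> \<in> borel_measurable \<mu>" "\<Phi>' \<in> borel_measurable \<mu>"
    using assms(3,4) by (auto simp: L_space_2)
  define m where "m = real_of_ereal (min 0 (essinf \<mu> \<Phi>'))"
  \<comment> \<open>The case assumption excludes minus infinity and the minimum with 0 excludes plus
    infinity, so \<open>real_of_ereal\<close> returns no default value here.\<close>
  have m: "ereal m = min 0 (essinf \<mu> \<Phi>')"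
    using False unfolding m_def by (cases "essinf \<mu> \<Phi>'") (auto simp: min_def)
  have "m \<le> 0"
    using m by (metis ereal_less_eq(3) min.cobounded1 zero_ereal_def)
  have nonneg: "AE x in \<mu>. 0 \<le> \<Phi> x"
    using AE_essinf_le[of \<Phi> \<mu>] assms(5) by simp
  have AE: "AE x in \<mu>. m \<le> \<Phi> x" "AE x in \<mu>. m \<le> \<Phi>' x"
  proof -
    show "AE x in \<mu>. m \<le> \<Phi> x"
      using nonneg by eventually_elim (use \<open>m \<le> 0\<close> in simp)
    have "ereal m \<le> essinf \<mu> \<Phi>'"
      by (simp add: m)
    with AE_essinf_le[of \<Phi>' \<mu>] show "AE x in \<mu>. m \<le> \<Phi>' x"
      by (auto elim!: eventually_mono dest: order_trans)
  qed
  have I: "integrable \<mu> (\<lambda>x. exp (- \<Phi> x))"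
    using assms(1,5) by (intro integrable_exp_neg) auto
  \<comment> \<open>The normalisation of \<Phi> bounds its partition constant by the total mass 1,
    hence also the minimum of the two constants.\<close>
  have "?Z \<le> (\<integral>x. 1 \<partial>\<mu>)"
    unfolding partition_const_def using I nonneg by (intro integral_mono_AE) auto
  then have "?Z \<le> 1"
    by (simp add: prob_space)
  define z where "z = min ?Z ?Z'"
  have z: "0 < z" "z \<le> 1"
    using partition_const_pos[OF assms(1)] I assms(6) \<open>?Z \<le> 1\<close> by (auto simp: z_def)
  \<comment> \<open>From \<open>sqrt z \<le> 1\<close> follows \<open>z \<le> sqrt z\<close>. So
    passing to the denominator \<open>z\<close> only enlarges the bound, as does replacing
    \<open>- m / 2\<close> by \<open>- m\<close>.\<close>
  have "z \<le> 2 * sqrt z"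
    using z mult_mono[of "sqrt z" 1 "sqrt z" 1] sqrt_le_D[of z 1] mult_left_mono[of "sqrt z" 1 "sqrt z"] by auto
  then have "exp (- m / 2) / (2 * sqrt z) \<le> exp (- m) / z"
    using z \<open>m \<le> 0\<close> by (intro frac_le) auto
  then have "exp (- m / 2) / (2 * sqrt z) * L_norm 2 \<mu> (\<lambda>x. \<Phi> x - \<Phi>' x)
      \<le> exp (- m) / z * L_norm 2 \<mu> (\<lambda>x. \<Phi> x - \<Phi>' x)"
    by (intro mult_right_mono) (auto simp: L_norm_2)
  with hellinger_dist_gibbs_measure_le[OF assms(1,3,4) AE I assms(6)]
  show ?thesis
    using False by (simp add: m_def z_def)
qed simp

end
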